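(* Let $\ell\ge 1$ and let $G$ be a finite subgraph of the $\mathbb{Z}^\ell$ lattice with $n$ vertices. Then \[\operatorname{pd}(G)\le n\left(1-\frac{1}{2\ell+1}\right).\]
   Context: The $\mathbb{Z}^\ell$ lattice is the infinite graph whose vertices are the points of $\mathbb{R}^\ell$ with integer coordinates, two vertices being adjacent when they are at Euclidean distance $1$. For a finite simple graph $G$ with vertex set $\{x_1,\dots,x_n\}$ and a fixed field $\mathbf{k}$, $S=\mathbf{k}[x_1,\dots,x_n]$, $I(G)=(x_ix_j:(x_i,x_j)\in E(G))$ is the edge ideal, and $\operatorname{pd}(G)$ is the projective dimension of $S/I(G)$. *)

theory Defs
  imports "HOL-Analysis.Analysis" "HOL-Library.Poly_Mapping"
begin

definition lattice_adj :: "int ^ 'l \<Rightarrow> int ^ 'l \<Rightarrow> bool" where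
  "lattice_adj a b \<longleftrightarrow> sqrt (real_of_int (\<Sum>i\<in>UNIV. (a $ i - b $ i)^2)) = 1"

definition lattice_subgraph :: "('v::finite \<Rightarrow> int ^ 'l) \<Rightarrow> ('v \<Rightarrow> 'v \<Rightarrow> bool) \<Rightarrow> bool" where
  "lattice_subgraph p E \<longleftrightarrow> inj p \<and> (\<forall>u v. E u v \<longrightarrow> E v u) \<and> (\<forall>u. \<not> E u u)
     \<and> (\<forall>u v. E u v \<longrightarrow> lattice_adj (p u) (p v))"

text \<open>S = k[x_v : v a vertex]: polynomials as finitely supported maps from
  monomials (exponent vectors) to coefficients.\<close>
type_synonym ('v, 'k) mpoly = "('v \<Rightarrow>\<^sub>0 nat) \<Rightarrow>\<^sub>0 'k"

definition Var :: "'v \<Rightarrow> ('v, 'k::comm_ring_1) mpoly" where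
  "Var v = Poly_Mapping.single (Poly_Mapping.single v 1) 1"

text \<open>The ideal generated by the x_u x_v for edges (finitely many generators,
  so it is the set of all S-linear combinations of them).\<close>
definition edge_ideal :: "('v::finite \<Rightarrow> 'v \<Rightarrow> bool) \<Rightarrow> ('v, 'k::comm_ring_1) mpoly set" where
  "edge_ideal E = {f. \<exists>c :: 'v \<Rightarrow> 'v \<Rightarrow> ('v, 'k) mpoly.
      f = (\<Sum>(u, v) \<in> {(u, v). E u v}. c u v * Var u * Var v)}"

text \<open>The free module R^r, as functions nat => R vanishing from index r on.\<close>
definition fvecs :: "nat \<Rightarrow> (nat \<Rightarrow> 'a::comm_ring_1) set" where
  "fvecs r = {v. \<forall>j\<ge>r. v j = 0}"

definition mat_app :: "nat \<Rightarrow> nat \<Rightarrow> (nat \<Rightarrow> nat \<Rightarrow> 'a::comm_ring_1) \<Rightarrow> (nat \<Rightarrow> 'a) \<Rightarrow> (nat \<Rightarrow> 'a)" where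
  "mat_app rout rin M v = (\<lambda>a. if a < rout then (\<Sum>b<rin. M a b * v b) else 0)"

text \<open>A finite free resolution of length (at most) p of the module R/I:
  0 -> F_p -> ... -> F_1 -> F_0 -> R/I -> 0, with F_i = R^(r i) (r i = 0 for i > p),
  differentials d i : F_i -> F_(i-1), and augmentation F_0 -> R/I sending the
  j-th basis vector to g j mod I.\<close>
definition free_resolution_quot ::
  "'a::comm_ring_1 set \<Rightarrow> nat \<Rightarrow> (nat \<Rightarrow> nat) \<Rightarrow> (nat \<Rightarrow> nat \<Rightarrow> nat \<Rightarrow> 'a) \<Rightarrow> (nat \<Rightarrow> 'a) \<Rightarrow> bool" where
  "free_resolution_quot I p r d g \<longleftrightarrow>
     (\<forall>i>p. r i = 0)
     \<comment> \<open>augmentation is surjective\<close>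
     \<and> (\<exists>v\<in>fvecs (r 0). (\<Sum>j<r 0. v j * g j) - 1 \<in> I)
     \<comment> \<open>exactness at F_0: kernel of augmentation = image of d 1\<close>
     \<and> {v \<in> fvecs (r 0). (\<Sum>j<r 0. v j * g j) \<in> I} = mat_app (r 0) (r 1) (d 1) ` fvecs (r 1)
     \<comment> \<open>exactness at F_i for i >= 1\<close>
     \<and> (\<forall>i\<ge>1. {v \<in> fvecs (r i). mat_app (r (i - 1)) (r i) (d i) v = (\<lambda>_. 0)}
                 = mat_app (r i) (r (i + 1)) (d (i + 1)) ` fvecs (r (i + 1)))"

definition proj_dim_quot :: "'a::comm_ring_1 set \<Rightarrow> nat" where
  "proj_dim_quot I = (LEAST p. \<exists>r d g. free_resolution_quot I p r d g)"

definition pd_graph :: "'k::field itself \<Rightarrow> ('v::finite \<Rightarrow> 'v \<Rightarrow> bool) \<Rightarrow> nat" where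
  "pd_graph _ E = proj_dim_quot (edge_ideal E :: ('v, 'k) mpoly set)"

end

theory Submission
  imports Defs
begin

text \<open>For a vertex \<open>x\<close> the exact sequence
  \<open>0 \<rightarrow> S/(I : x) \<rightarrow> S/I \<rightarrow> S/(I + (x)) \<rightarrow> 0\<close> and the horseshoe lemma bound \<open>pd G\<close> by the maximum of
  \<open>pd (G - N[x]) + deg x\<close> and \<open>pd (G - x) + 1\<close>. Let \<open>u\<close> be the non-isolated vertex minimising a linear
  functional with distinct positive coefficients, so that all neighbours of \<open>u\<close> have the form
  \<open>u + e\<^sub>j\<close>, and delete them one by one in decreasing order of the functional. When \<open>u + e\<^sub>j\<close> is
  reached, every neighbour deleted before is \<open>u + e\<^sub>m\<close> for an \<open>m\<close> with a larger coefficient, and by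
  minimality of \<open>u\<close> the lattice neighbour \<open>u + e\<^sub>j - e\<^sub>m\<close> is then missing. Hence the number of earlier
  deletions plus the degree of \<open>u + e\<^sub>j\<close> is at most \<open>2 \<ell>\<close>. So in every branch some \<open>k \<le> 2 \<ell>\<close> is added to
  the projective dimension while at least \<open>k + 1\<close> non-isolated vertices disappear.\<close>

section \<open>Free resolutions of submodules of free modules\<close>

definition submod :: "(nat \<Rightarrow> 'a::comm_ring_1) set \<Rightarrow> bool" where
  "submod K \<longleftrightarrow> (\<lambda>_. 0) \<in> K \<and> (\<forall>u\<in>K. \<forall>v\<in>K. (\<lambda>i. u i + v i) \<in> K)
     \<and> (\<forall>c. \<forall>v\<in>K. (\<lambda>i. c * v i) \<in> K)"

lemma submod_add: "submod K \<Longrightarrow> u \<in> K \<Longrightarrow> v \<in> K \<Longrightarrow> (\<lambda>i. u i + v i) \<in> K"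
  and submod_scale: "submod K \<Longrightarrow> v \<in> K \<Longrightarrow> (\<lambda>i. c * v i) \<in> K"
  and submod_zero: "submod K \<Longrightarrow> (\<lambda>_. 0) \<in> K"
  by (auto simp: submod_def)

lemma submod_diff:
  assumes "submod K" "u \<in> K" "v \<in> K"
  shows "(\<lambda>i. u i - v i) \<in> K"
  using submod_add[OF assms(1,2) submod_scale[OF assms(1,3), of "-1"]] by simp

lemma submod_lincomb:
  assumes "submod K" "\<And>j. j < (t::nat) \<Longrightarrow> w j \<in> K"
  shows "(\<lambda>i. \<Sum>j<t. c j * w j i) \<in> K"
  using assms(2)
proof (induction t)
  case 0
  then show ?case using submod_zero[OF assms(1)] by simp
next
  case (Suc t)
  then show ?case
    using submod_add[OF assms(1) Suc.IH submod_scale[OF assms(1) Suc.prems[of t], of "c t"]] by simp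
qed

lemma mat_app_add: "mat_app r s M (\<lambda>i. u i + v i) = (\<lambda>i. mat_app r s M u i + mat_app r s M v i)"
  by (auto simp: mat_app_def distrib_left sum.distrib)

lemma mat_app_scale: "mat_app r s M (\<lambda>i. c * u i) = (\<lambda>i. c * mat_app r s M u i)"
  by (auto simp: mat_app_def sum_distrib_left mult_ac)

lemma mat_app_zero: "mat_app r s M (\<lambda>_. 0) = (\<lambda>_. 0)"
  by (auto simp: mat_app_def)

lemma mat_app_cong: "(\<And>j. j < s \<Longrightarrow> u j = v j) \<Longrightarrow> mat_app r s M u = mat_app r s M v"
  by (auto simp: mat_app_def fun_eq_iff intro!: sum.cong)

lemma fvecs_0: "fvecs 0 = {\<lambda>_. 0}"
  by (auto simp: fvecs_def)

lemma zero_in_fvecs: "(\<lambda>_. 0) \<in> fvecs r"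
  by (simp add: fvecs_def)

lemma submod_mat_app_kernel: "submod {v \<in> fvecs s. mat_app r s M v = (\<lambda>_. 0)}"
  by (auto simp: submod_def mat_app_add mat_app_scale mat_app_zero fvecs_def)

lemma submod_mat_app_image: "submod (mat_app r s M ` fvecs s)"
  unfolding submod_def
proof (intro conjI ballI allI)
  show "(\<lambda>_. 0) \<in> mat_app r s M ` fvecs s"
    by (rule image_eqI[OF _ zero_in_fvecs]) (simp only: mat_app_zero)
next
  fix x y assume "x \<in> mat_app r s M ` fvecs s" "y \<in> mat_app r s M ` fvecs s"
  then obtain u v where "u \<in> fvecs s" "v \<in> fvecs s" "x = mat_app r s M u" "y = mat_app r s M v"
    by blast
  then show "(\<lambda>i. x i + y i) \<in> mat_app r s M ` fvecs s"
    by (intro image_eqI[where x = "\<lambda>i. u i + v i"]) (auto simp: mat_app_add fvecs_def)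
next
  fix c x assume "x \<in> mat_app r s M ` fvecs s"
  then obtain u where "u \<in> fvecs s" "x = mat_app r s M u"
    by blast
  then show "(\<lambda>i. c * x i) \<in> mat_app r s M ` fvecs s"
    by (intro image_eqI[where x = "\<lambda>i. c * u i"]) (auto simp: mat_app_scale fvecs_def)
qed

text \<open>A free resolution of the submodule \<open>K\<close> of \<open>R\<^sup>r\<close>; the length is counted for \<open>R\<^sup>r / K\<close>, so that length
  \<open>0\<close> means \<open>K = 0\<close>.\<close>

fun has_resolution :: "nat \<Rightarrow> nat \<Rightarrow> (nat \<Rightarrow> 'a::comm_ring_1) set \<Rightarrow> bool" where
  "has_resolution 0 r K \<longleftrightarrow> K = {\<lambda>_. 0}"
| "has_resolution (Suc p) r K \<longleftrightarrow>
     (\<exists>s M. K = mat_app r s M ` fvecs s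
          \<and> has_resolution p s {v \<in> fvecs s. mat_app r s M v = (\<lambda>_. 0)})"

text \<open>Appending \<open>R^0\<close> at the far end lengthens a resolution; it maps onto the
  zero kernel.\<close>

lemma has_resolution_Suc_mono: "has_resolution p r K \<Longrightarrow> has_resolution (Suc p) r K"
proof (induction p arbitrary: r K)
  case 0
  then show ?case
    by (auto simp: fvecs_0 mat_app_zero intro!: exI[of _ 0])
next
  case (Suc p)
  then obtain s M where "K = mat_app r s M ` fvecs s"
    "has_resolution p s {v \<in> fvecs s. mat_app r s M v = (\<lambda>_. 0)}"
    unfolding has_resolution.simps by blast
  with Suc.IH show ?case
    using has_resolution.simps(2) by blast
qed

lemma has_resolution_mono:
  assumes "has_resolution p r K" "p \<le> q"
  shows "has_resolution q r K"
  using assms(2,1) by (induction rule: dec_induct) (blast intro: has_resolution_Suc_mono)+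

lemma sum_lessThan_add: "(\<Sum>j<s + t. f j) = (\<Sum>j<s. f j) + (\<Sum>j<t. f (s + j))"
  for f :: "nat \<Rightarrow> 'a::comm_monoid_add"
  by (induction t) (auto simp: add.assoc)

text \<open>The horseshoe lemma for the exact sequence formed by a submodule of a direct sum,
  its intersection with the first summand and its projection to the second one.\<close>

lemma has_resolution_horseshoe:
  assumes "submod K" "K \<subseteq> fvecs (a + c)"
    and "has_resolution p a (K \<inter> fvecs a)"
    and "has_resolution p c ((\<lambda>v i. v (a + i)) ` K)"
  shows "has_resolution p (a + c) K"
  using assms
proof (induction p arbitrary: a c K)
  case 0
  have "v = (\<lambda>_. 0)" if "v \<in> K" for v
  proof -
    have "(\<lambda>i. v (a + i)) = (\<lambda>_. 0)"
      using 0(4) that unfolding has_resolution.simps by blast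
    then have "v j = 0" if "j \<ge> a" for j
      using that by (metis le_add_diff_inverse)
    with that have "v \<in> K \<inter> fvecs a"
      by (simp add: fvecs_def)
    then show ?thesis using 0(3) unfolding has_resolution.simps by blast
  qed
  then show ?case using submod_zero[OF 0(1)] unfolding has_resolution.simps by blast
next
  case (Suc p)
  note K = Suc.prems(1,2)
  obtain s M where M: "K \<inter> fvecs a = mat_app a s M ` fvecs s"
    and pM: "has_resolution p s {v \<in> fvecs s. mat_app a s M v = (\<lambda>_. 0)}"
    using Suc.prems(3) unfolding has_resolution.simps by blast
  obtain t N where N: "(\<lambda>v i. v (a + i)) ` K = mat_app c t N ` fvecs t"
    and pN: "has_resolution p t {v \<in> fvecs t. mat_app c t N v = (\<lambda>_. 0)}"
    using Suc.prems(4) unfolding has_resolution.simps by blast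
  \<comment> \<open>Applying \<open>N\<close> to the \<open>j\<close>-th unit vector yields its
    \<open>j\<close>-th column, which therefore lifts to an element of \<open>K\<close>. Rows from
    \<open>c\<close> on are set to zero because \<open>mat_app\<close> ignores them.\<close>
  have "\<exists>w\<in>K. (\<lambda>i. w (a + i)) = (\<lambda>i. if i < c then N i j else 0)" if "j < t" for j
  proof -
    have "mat_app c t N (\<lambda>i. if i = j then 1 else 0) \<in> (\<lambda>v i. v (a + i)) ` K"
      unfolding N using that by (intro imageI) (auto simp: fvecs_def)
    moreover have "mat_app c t N (\<lambda>i. if i = j then 1 else 0) = (\<lambda>i. if i < c then N i j else 0)"
      using that by (auto simp: mat_app_def if_distrib[of "\<lambda>x. _ * x"] sum.delta cong: if_cong)
    ultimately have "(\<lambda>i. if i < c then N i j else 0) \<in> (\<lambda>v i. v (a + i)) ` K"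
      by (simp only:)
    then show ?thesis
      by (auto simp only: image_iff)
  qed
  then have "\<forall>j\<in>{..<t}. \<exists>w. w \<in> K \<and> (\<lambda>i. w (a + i)) = (\<lambda>i. if i < c then N i j else 0)"
    by blast
  from bchoice[OF this] obtain w where wK: "\<And>j. j < t \<Longrightarrow> w j \<in> K"
    and w: "\<And>j i. j < t \<Longrightarrow> w j (a + i) = (if i < c then N i j else 0)"
    by (auto simp: fun_eq_iff)
  have w0: "w j i = 0" if "j < t" "i \<ge> a + c" for i j
    using wK[OF that(1)] K(2) that(2) by (auto simp: fvecs_def)
  \<comment> \<open>Block matrix: \<open>M\<close> padded by zero rows, followed by the lifts
    \<open>w\<close> of the columns of \<open>N\<close>.\<close>
  define L where "L = (\<lambda>i j. if j < s then (if i < a then M i j else 0) else w (j - s) i)"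
  have L: "mat_app (a + c) (s + t) L v = (\<lambda>i. mat_app a s M v i + (\<Sum>j<t. v (s + j) * w j i))" for v
    by (rule ext) (auto simp: mat_app_def L_def sum_lessThan_add w0 mult.commute)
  have Lshift: "mat_app (a + c) (s + t) L v (a + i) = mat_app c t N (\<lambda>j. v (s + j)) i" for v i
    unfolding L by (auto simp: mat_app_def w mult.commute intro!: sum.cong)
  have LK: "mat_app (a + c) (s + t) L v \<in> K" for v
  proof -
    have "mat_app a s M (\<lambda>j. if j < s then v j else 0) \<in> K \<inter> fvecs a"
      unfolding M by (intro imageI) (auto simp: fvecs_def)
    also have "mat_app a s M (\<lambda>j. if j < s then v j else 0) = mat_app a s M v"
      by (rule mat_app_cong) auto
    finally show ?thesis
      unfolding L by (intro submod_add[OF K(1)] submod_lincomb[OF K(1)] wK) auto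
  qed
  \<comment> \<open>Subtracting the combination of lifts given by \<open>u\<close> leaves an element
    of \<open>K\<close> supported on the first \<open>a\<close> coordinates, hence in the image of
    \<open>M\<close>. Arbitrary \<open>z\<close> gives surjectivity onto \<open>K\<close>, and
    \<open>z = 0\<close> handles the kernel.\<close>
  have lift: "\<exists>v\<in>fvecs (s + t). (\<lambda>j. v (s + j)) = u \<and> mat_app (a + c) (s + t) L v = z"
    if u: "u \<in> fvecs t" and z: "z \<in> K" "(\<lambda>i. z (a + i)) = mat_app c t N u" for u z
  proof -
    define y where "y = (\<lambda>i. z i - (\<Sum>j<t. u j * w j i))"
    have "y \<in> K"
      unfolding y_def by (intro submod_diff[OF K(1)] z submod_lincomb[OF K(1)] wK)
    moreover have y0: "y (a + i) = 0" for i
      using fun_cong[OF z(2), of i] by (auto simp: y_def mat_app_def w mult.commute intro!: sum.cong)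
    have "y j = 0" if "j \<ge> a" for j
      using y0[of "j - a"] that by simp
    then have "y \<in> fvecs a"
      by (simp add: fvecs_def)
    ultimately obtain q where q: "q \<in> fvecs s" "y = mat_app a s M q"
      using M by blast
    define v where "v = (\<lambda>j. if j < s then q j else u (j - s))"
    have "v \<in> fvecs (s + t)"
      using u by (auto simp: v_def fvecs_def)
    moreover have vu: "(\<lambda>j. v (s + j)) = u"
      by (auto simp: v_def)
    moreover have "mat_app a s M v = y"
      unfolding q by (rule mat_app_cong) (auto simp: v_def)
    then have "mat_app (a + c) (s + t) L v = z"
      unfolding L using fun_cong[OF vu] by (simp add: y_def fun_eq_iff)
    ultimately show ?thesis by blast
  qed
  let ?ker = "{v \<in> fvecs (s + t). mat_app (a + c) (s + t) L v = (\<lambda>_. 0)}"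
  have img: "K = mat_app (a + c) (s + t) L ` fvecs (s + t)"
  proof
    show "K \<subseteq> mat_app (a + c) (s + t) L ` fvecs (s + t)"
    proof
      fix z assume z: "z \<in> K"
      then obtain u where "u \<in> fvecs t" "(\<lambda>i. z (a + i)) = mat_app c t N u"
        using N by blast
      from lift[OF this(1) z this(2)] show "z \<in> mat_app (a + c) (s + t) L ` fvecs (s + t)"
        by blast
    qed
  qed (use LK in auto)
  \<comment> \<open>The kernel of \<open>L\<close> has the same shape as \<open>K\<close>: it meets
    the first summand in the kernel of \<open>M\<close> and projects onto the kernel of
    \<open>N\<close>.\<close>
  have "has_resolution p (s + t) ?ker"
  proof (rule Suc.IH)
    show "submod ?ker" by (rule submod_mat_app_kernel)
    have "mat_app (a + c) (s + t) L v = mat_app a s M v" if "v \<in> fvecs s" for v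
      using that unfolding L by (auto simp: fvecs_def)
    moreover have "fvecs s \<subseteq> fvecs (s + t)"
      by (auto simp: fvecs_def)
    ultimately have "?ker \<inter> fvecs s = {v \<in> fvecs s. mat_app a s M v = (\<lambda>_. 0)}"
      by auto
    with pM show "has_resolution p s (?ker \<inter> fvecs s)"
      by (simp only:)
    have "(\<lambda>v i. v (s + i)) ` ?ker = {v \<in> fvecs t. mat_app c t N v = (\<lambda>_. 0)}" (is "?l = ?r")
    proof
      show "?l \<subseteq> ?r"
      proof
        fix u assume "u \<in> ?l"
        then obtain v where v: "v \<in> fvecs (s + t)" and 0: "mat_app (a + c) (s + t) L v = (\<lambda>_. 0)"
          and u: "u = (\<lambda>i. v (s + i))"
          by blast
        have "mat_app c t N u = (\<lambda>_. 0)"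
          unfolding u using Lshift[of v] fun_cong[OF 0] by (simp add: fun_eq_iff)
        with u v show "u \<in> ?r"
          by (simp add: fvecs_def)
      qed
      show "?r \<subseteq> ?l"
      proof
        fix u assume "u \<in> ?r"
        then have "u \<in> fvecs t" "(\<lambda>i. (\<lambda>_. 0) (a + i)) = mat_app c t N u"
          by simp_all
        from lift[OF this(1) submod_zero[OF K(1)] this(2)] show "u \<in> ?l" by blast
      qed
    qed
    with pN show "has_resolution p t ((\<lambda>v i. v (s + i)) ` ?ker)"
      by (simp only:)
  qed auto
  with img show ?case
    unfolding has_resolution.simps by blast
qed

text \<open>The relations between the generators of \<open>K + x F\<close> form an extension of \<open>K\<close> by the relations
  between the generators of \<open>K\<close>, so the horseshoe lemma applies to them and no mapping cone is
  needed.\<close>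

lemma has_resolution_regular_element:
  assumes "has_resolution p r K" "K \<subseteq> fvecs r"
    and regular: "\<And>v. v \<in> fvecs r \<Longrightarrow> (\<lambda>i. x * v i) \<in> K \<Longrightarrow> v \<in> K"
  shows "has_resolution (Suc p) r {(\<lambda>i. k i + x * v i) | k v. k \<in> K \<and> v \<in> fvecs r}"
proof -
  \<comment> \<open>The resolution is lengthened first so that \<open>K\<close> has a presentation
    also for \<open>p = 0\<close>; its relations then have a resolution of length
    \<open>p\<close>.\<close>
  obtain s M where M: "K = mat_app r s M ` fvecs s"
    and pM: "has_resolution p s {v \<in> fvecs s. mat_app r s M v = (\<lambda>_. 0)}"
    using has_resolution_Suc_mono[OF assms(1)] unfolding has_resolution.simps by blast
  have K: "submod K"
    unfolding M by (rule submod_mat_app_image)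
  define L where "L = (\<lambda>i j. if j < s then M i j else if j - s = i then x else 0)"
  have L: "mat_app r (s + r) L v = (\<lambda>i. mat_app r s M v i + (if i < r then x * v (s + i) else 0))" for v
    by (rule ext) (auto simp: mat_app_def L_def sum_lessThan_add if_distrib[of "\<lambda>x. x * _"] sum.delta
        cong: if_cong)
  have L': "mat_app r (s + r) L v = (\<lambda>i. mat_app r s M v i + x * v (s + i))" if "v \<in> fvecs (s + r)" for v
    unfolding L using that by (auto simp: fvecs_def)
  have MK: "mat_app r s M v \<in> K" for v
  proof -
    have "mat_app r s M v = mat_app r s M (\<lambda>j. if j < s then v j else 0)"
      by (rule mat_app_cong) auto
    also have "\<dots> \<in> K"
      unfolding M by (intro imageI) (auto simp: fvecs_def)
    finally show ?thesis .
  qed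
  have join: "(\<lambda>j. if j < s then y j else v (j - s)) \<in> fvecs (s + r)" if "v \<in> fvecs r" for y v
    using that by (auto simp: fvecs_def)
  have Ljoin: "mat_app r (s + r) L (\<lambda>j. if j < s then y j else v (j - s))
      = (\<lambda>i. mat_app r s M y i + x * v i)" if "v \<in> fvecs r" for y v
  proof -
    have "mat_app r s M (\<lambda>j. if j < s then y j else v (j - s)) = mat_app r s M y"
      by (rule mat_app_cong) auto
    then show ?thesis
      unfolding L'[OF join[OF that]] by simp
  qed
  let ?ker = "{v \<in> fvecs (s + r). mat_app r (s + r) L v = (\<lambda>_. 0)}"
  have img: "{(\<lambda>i. k i + x * v i) | k v. k \<in> K \<and> v \<in> fvecs r} = mat_app r (s + r) L ` fvecs (s + r)"
    (is "?l = ?r")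
  proof
    show "?l \<subseteq> ?r"
    proof
      fix z assume "z \<in> ?l"
      then obtain y v where "v \<in> fvecs r" "z = (\<lambda>i. mat_app r s M y i + x * v i)"
        unfolding M by blast
      then show "z \<in> ?r"
        by (intro image_eqI[OF _ join]) (simp_all only: Ljoin)
    qed
    show "?r \<subseteq> ?l"
    proof
      fix z assume "z \<in> ?r"
      then obtain v where v: "v \<in> fvecs (s + r)" and z: "z = mat_app r (s + r) L v"
        by blast
      have "(\<lambda>i. v (s + i)) \<in> fvecs r"
        using v by (simp add: fvecs_def)
      then show "z \<in> ?l"
        unfolding z L'[OF v] using MK[of v]
        by (intro CollectI exI[of _ "mat_app r s M v"] exI[of _ "\<lambda>i. v (s + i)"]) simp
    qed
  qed
  have "has_resolution p (s + r) ?ker"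
  proof (rule has_resolution_horseshoe)
    show "submod ?ker" by (rule submod_mat_app_kernel)
    have "mat_app r (s + r) L v = mat_app r s M v" if "v \<in> fvecs s" for v
      using that unfolding L by (auto simp: fvecs_def)
    moreover have "fvecs s \<subseteq> fvecs (s + r)"
      by (auto simp: fvecs_def)
    ultimately have "?ker \<inter> fvecs s = {v \<in> fvecs s. mat_app r s M v = (\<lambda>_. 0)}"
      by auto
    with pM show "has_resolution p s (?ker \<inter> fvecs s)"
      by (simp only:)
    \<comment> \<open>A relation \<open>(y, v)\<close> means \<open>M y = - x v\<close>, so
      regularity puts \<open>v\<close> in \<open>K\<close>; conversely \<open>z = M y\<close> comes
      from the relation \<open>(- x y, z)\<close>.\<close>
    have "(\<lambda>v i. v (s + i)) ` ?ker = K" (is "?l = _")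
    proof
      show "?l \<subseteq> K"
      proof
        fix z assume "z \<in> ?l"
        then obtain v where v: "v \<in> fvecs (s + r)" and 0: "mat_app r (s + r) L v = (\<lambda>_. 0)"
          and z: "z = (\<lambda>i. v (s + i))"
          by blast
        have "x * z i = - mat_app r s M v i" for i
          using fun_cong[OF 0, of i] unfolding L'[OF v] z by (simp add: eq_neg_iff_add_eq_0 add.commute)
        then have "(\<lambda>i. x * z i) \<in> K"
          using submod_scale[OF K MK, of "-1" v] by simp
        with regular v show "z \<in> K"
          unfolding z by (simp add: fvecs_def)
      qed
      show "K \<subseteq> ?l"
      proof
        fix z assume z: "z \<in> K"
        then obtain y where y: "z = mat_app r s M y"
          using M by blast
        have zr: "z \<in> fvecs r" using z assms(2) by blast
        let ?v = "\<lambda>j. if j < s then - x * y j else z (j - s)"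
        have "mat_app r (s + r) L ?v = (\<lambda>_. 0)"
          unfolding Ljoin[OF zr] mat_app_scale using y by simp
        then show "z \<in> ?l"
          using join[OF zr, of "\<lambda>j. - x * y j"] by (intro image_eqI[where x = ?v]) auto
      qed
    qed
    with assms(1) show "has_resolution p r ((\<lambda>v i. v (s + i)) ` ?ker)"
      by (simp only:)
  qed auto
  with img show ?thesis
    unfolding has_resolution.simps by blast
qed

section \<open>Resolutions of cyclic modules\<close>

definition is_ideal :: "'a::comm_ring_1 set \<Rightarrow> bool" where
  "is_ideal I \<longleftrightarrow> 0 \<in> I \<and> (\<forall>f\<in>I. \<forall>g\<in>I. f + g \<in> I) \<and> (\<forall>c. \<forall>f\<in>I. c * f \<in> I)"

lemma is_ideal_add: "is_ideal I \<Longrightarrow> f \<in> I \<Longrightarrow> g \<in> I \<Longrightarrow> f + g \<in> I"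
  and is_ideal_mult: "is_ideal I \<Longrightarrow> f \<in> I \<Longrightarrow> c * f \<in> I"
  and is_ideal_zero: "is_ideal I \<Longrightarrow> 0 \<in> I"
  by (auto simp: is_ideal_def)

lemma is_ideal_diff: "is_ideal I \<Longrightarrow> f \<in> I \<Longrightarrow> g \<in> I \<Longrightarrow> f - g \<in> I"
  using is_ideal_add[of I f "- 1 * g"] is_ideal_mult[of I g "- 1"] by simp

text \<open>Any number of generators \<open>g\<close> is allowed, since the middle term of an exact
  sequence is naturally presented by the generators of both ends. As the quotient is cyclic,
  surjectivity only asks for a combination congruent to 1.\<close>

definition pd_quot_le :: "'a::comm_ring_1 set \<Rightarrow> nat \<Rightarrow> bool" where
  "pd_quot_le I p \<longleftrightarrow> (\<exists>r g. (\<exists>v\<in>fvecs r. (\<Sum>j<r. v j * g j) - 1 \<in> I)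
     \<and> has_resolution p r {v \<in> fvecs r. (\<Sum>j<r. v j * g j) \<in> I})"

lemma pd_quot_le_mono: "pd_quot_le I p \<Longrightarrow> p \<le> q \<Longrightarrow> pd_quot_le I q"
  unfolding pd_quot_le_def using has_resolution_mono by blast

text \<open>Unrolls the nested existentials of \<open>has_resolution\<close> into one sequence of
  ranks and one of matrices, the format of \<open>free_resolution_quot\<close>.\<close>

lemma has_resolution_imp_complex:
  assumes "has_resolution p r K"
  shows "\<exists>rs d. rs 0 = r \<and> (\<forall>i>p. rs i = 0)
     \<and> K = mat_app (rs 0) (rs 1) (d 1) ` fvecs (rs 1)
     \<and> (\<forall>i\<ge>1. {v \<in> fvecs (rs i). mat_app (rs (i - 1)) (rs i) (d i) v = (\<lambda>_. 0)}
                 = mat_app (rs i) (rs (i + 1)) (d (i + 1)) ` fvecs (rs (i + 1)))"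
  using assms
proof (induction p arbitrary: r K)
  case 0
  have "{v \<in> {\<lambda>_. 0}. mat_app q s M v = (\<lambda>_. 0)} = {\<lambda>_. 0}" for q s and M :: "nat \<Rightarrow> nat \<Rightarrow> 'a"
    by (auto simp only: mat_app_zero)
  with 0 show ?case
    by (intro exI[of _ "\<lambda>i. if i = 0 then r else 0"] exI[of _ "\<lambda>_ _ _. 0"])
      (simp add: fvecs_0 mat_app_zero del: Collect_conv_if Collect_conv_if2)
next
  case (Suc p)
  then obtain s M where M: "K = mat_app r s M ` fvecs s"
    and pM: "has_resolution p s {v \<in> fvecs s. mat_app r s M v = (\<lambda>_. 0)}"
    unfolding has_resolution.simps by blast
  from Suc.IH[OF pM] obtain rs d where IH: "rs 0 = s" "\<And>i. i > p \<Longrightarrow> rs i = 0"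
      "{v \<in> fvecs s. mat_app r s M v = (\<lambda>_. 0)} = mat_app (rs 0) (rs 1) (d 1) ` fvecs (rs 1)"
      "\<And>i. i \<ge> 1 \<Longrightarrow> {v \<in> fvecs (rs i). mat_app (rs (i - 1)) (rs i) (d i) v = (\<lambda>_. 0)}
                 = mat_app (rs i) (rs (i + 1)) (d (i + 1)) ` fvecs (rs (i + 1))"
    by blast
  \<comment> \<open>The tail moves up by one degree and \<open>M\<close> becomes the first
    differential. Differentials start at index 1, so index 0 gets an arbitrary value.\<close>
  let ?rs = "case_nat r rs" and ?d = "case_nat undefined (case_nat M (\<lambda>i. d (Suc i)))"
  have "{v \<in> fvecs (?rs i). mat_app (?rs (i - 1)) (?rs i) (?d i) v = (\<lambda>_. 0)}
      = mat_app (?rs i) (?rs (i + 1)) (?d (i + 1)) ` fvecs (?rs (i + 1))" if "i \<ge> 1" for i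
  proof (cases "i = 1")
    case True
    then show ?thesis using IH(1,3) by simp
  next
    case False
    with that have "i = Suc (Suc (i - 2))"
      by simp
    then obtain j where "i = Suc (Suc j)" ..
    then show ?thesis using IH(4)[of "Suc j"] by simp
  qed
  moreover have "?rs i = 0" if "i > Suc p" for i
    using IH(2) that by (cases i) auto
  ultimately show ?case
    using M IH(1) by (intro exI[of _ ?rs] exI[of _ ?d] conjI allI impI) simp_all
qed

lemma proj_dim_quot_le:
  assumes "pd_quot_le I p"
  shows "proj_dim_quot I \<le> p"
proof -
  obtain r g where 1: "\<exists>v\<in>fvecs r. (\<Sum>j<r. v j * g j) - 1 \<in> I"
    and 2: "has_resolution p r {v \<in> fvecs r. (\<Sum>j<r. v j * g j) \<in> I}"
    using assms unfolding pd_quot_le_def by blast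
  from has_resolution_imp_complex[OF 2] obtain rs d where "rs 0 = r" "free_resolution_quot I p rs d g"
    unfolding free_resolution_quot_def using 1 by blast
  then show ?thesis
    unfolding proj_dim_quot_def by (intro Least_le) blast
qed

lemma pd_quot_le_zero_ideal: "pd_quot_le ({0} :: 'a::comm_ring_1 set) 0"
proof -
  have "{v \<in> fvecs 1. (\<Sum>j<1. v j * (1::'a)) \<in> {0}} = {\<lambda>_. 0}"
    by (auto simp: fvecs_def fun_eq_iff) (metis One_nat_def Suc_leI gr0I)
  moreover have "(\<lambda>j. if j = 0 then 1 else 0) \<in> fvecs 1"
    by (auto simp: fvecs_def)
  ultimately show ?thesis
    unfolding pd_quot_le_def
    by (intro exI[of _ 1] exI[of _ "\<lambda>_. 1"] conjI bexI[of _ "\<lambda>j. if j = 0 then 1 else 0"]) auto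
qed

text \<open>If \<open>K\<close> is the kernel of the augmentation \<open>F -> R/I\<close>, then
  \<open>K + x F\<close> is the kernel of the one onto \<open>R/(I + xR)\<close>, and a resolution
  of \<open>K + x F\<close> is already available.\<close>

lemma pd_quot_le_regular_element:
  assumes I: "is_ideal I" and "pd_quot_le I p" and regular: "\<And>f. x * f \<in> I \<Longrightarrow> f \<in> I"
  shows "pd_quot_le {f + x * h | f h. f \<in> I} (Suc p)"
proof -
  obtain r g u where u: "u \<in> fvecs r" "(\<Sum>j<r. u j * g j) - 1 \<in> I"
    and res: "has_resolution p r {v \<in> fvecs r. (\<Sum>j<r. v j * g j) \<in> I}"
    using assms(2) unfolding pd_quot_le_def by blast
  let ?K = "{v \<in> fvecs r. (\<Sum>j<r. v j * g j) \<in> I}"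
  have scale: "(\<Sum>j<r. (c * v j) * g j) = c * (\<Sum>j<r. v j * g j)" for c v
    by (simp add: sum_distrib_left mult.assoc)
  have "{(\<lambda>i. k i + x * v i) | k v. k \<in> ?K \<and> v \<in> fvecs r}
      = {v \<in> fvecs r. (\<Sum>j<r. v j * g j) \<in> {f + x * h | f h. f \<in> I}}" (is "?l = ?r")
  proof
    show "?l \<subseteq> ?r"
    proof
      fix z assume "z \<in> ?l"
      then obtain k v where kv: "k \<in> ?K" "v \<in> fvecs r" and z: "z = (\<lambda>i. k i + x * v i)"
        by blast
      have "(\<Sum>j<r. z j * g j) = (\<Sum>j<r. k j * g j) + x * (\<Sum>j<r. v j * g j)"
        by (simp only: z distrib_right sum.distrib scale)
      with kv z show "z \<in> ?r"
        by (auto simp: fvecs_def)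
    qed
    show "?r \<subseteq> ?l"
    proof
      fix z assume "z \<in> ?r"
      then obtain f h where z: "z \<in> fvecs r" and f: "f \<in> I" and zf: "(\<Sum>j<r. z j * g j) = f + x * h"
        by blast
      \<comment> \<open>As \<open>u\<close> maps to 1 modulo \<open>I\<close>, the vector
        \<open>x h u\<close> accounts for the part \<open>x * h\<close>, leaving a remainder in
        \<open>?K\<close>.\<close>
      define k where "k = (\<lambda>i. z i - x * (h * u i))"
      have "(\<Sum>j<r. k j * g j) = (\<Sum>j<r. z j * g j) - x * (h * (\<Sum>j<r. u j * g j))"
        by (simp only: k_def left_diff_distrib sum_subtractf scale)
      also have "\<dots> = f - x * h * ((\<Sum>j<r. u j * g j) - 1)"
        unfolding zf by (simp only: algebra_simps mult_1_right) simp
      also have "\<dots> \<in> I"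
        by (intro is_ideal_diff[OF I] f is_ideal_mult[OF I] u)
      finally have "k \<in> ?K"
        using z u by (auto simp: k_def fvecs_def)
      moreover have "(\<lambda>i. h * u i) \<in> fvecs r" "z = (\<lambda>i. k i + x * (h * u i))"
        using u by (auto simp: k_def fvecs_def)
      ultimately show "z \<in> ?l"
        by (intro CollectI exI[of _ k] exI[of _ "\<lambda>i. h * u i"]) simp
    qed
  qed
  moreover have "has_resolution (Suc p) r {(\<lambda>i. k i + x * v i) | k v. k \<in> ?K \<and> v \<in> fvecs r}"
    using res by (rule has_resolution_regular_element) (auto simp: scale intro: regular)
  ultimately have "has_resolution (Suc p) r
      {v \<in> fvecs r. (\<Sum>j<r. v j * g j) \<in> {f + x * h | f h. f \<in> I}}"
    by (simp only:)
  moreover have "(\<Sum>j<r. u j * g j) - 1 \<in> {f + x * h | f h. f \<in> I}"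
    using u(2) by (metis (mono_tags, lifting) add.right_neutral mem_Collect_eq mult_zero_right)
  ultimately show ?thesis
    unfolding pd_quot_le_def using u(1) by blast
qed

text \<open>Horseshoe lemma for \<open>0 -> R/(I : x) -> R/I -> R/(I + xR) -> 0\<close>. The first
  map is multiplication by \<open>x\<close>, so the generators of the left end enter multiplied by
  \<open>x\<close>.\<close>

lemma pd_quot_le_colon:
  assumes I: "is_ideal I" and "pd_quot_le {f. x * f \<in> I} p"
    and "pd_quot_le {f + x * h | f h. f \<in> I} p"
  shows "pd_quot_le I p"
proof -
  obtain a g u where u: "u \<in> fvecs a" "x * ((\<Sum>j<a. u j * g j) - 1) \<in> I"
    and resA: "has_resolution p a {v \<in> fvecs a. x * (\<Sum>j<a. v j * g j) \<in> I}"
    using assms(2) unfolding pd_quot_le_def mem_Collect_eq by blast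
  obtain c h w where w: "w \<in> fvecs c" "(\<Sum>j<c. w j * h j) - 1 \<in> {f + x * h | f h. f \<in> I}"
    and resC: "has_resolution p c {v \<in> fvecs c. (\<Sum>j<c. v j * h j) \<in> {f + x * h | f h. f \<in> I}}"
    using assms(3) unfolding pd_quot_le_def by blast
  define G where "G = (\<lambda>j. if j < a then x * g j else h (j - a))"
  have G: "(\<Sum>j<a + c. v j * G j) = x * (\<Sum>j<a. v j * g j) + (\<Sum>j<c. v (a + j) * h j)" for v
    by (simp add: sum_lessThan_add G_def sum_distrib_left mult_ac)
  have lift: "\<exists>z\<in>fvecs (a + c). (\<lambda>j. z (a + j)) = v \<and> (\<Sum>j<a + c. z j * G j) - e \<in> I"
    if v: "v \<in> fvecs c" and e: "(\<Sum>j<c. v j * h j) - e \<in> {f + x * h | f h. f \<in> I}" for v e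
  proof -
    obtain f q where f: "f \<in> I" and q: "(\<Sum>j<c. v j * h j) - e = f + x * q"
      using e by blast
    \<comment> \<open>The error \<open>x * q\<close> is cancelled by \<open>- q u\<close>, since
      \<open>x\<close> times the combination \<open>u\<close> of the \<open>g j\<close> is congruent
      to \<open>x\<close> modulo \<open>I\<close>. The value \<open>e = 0\<close> serves the kernel,
      \<open>e = 1\<close> surjectivity.\<close>
    define z where "z = (\<lambda>j. if j < a then - q * u j else v (j - a))"
    have "(\<Sum>j<a. z j * g j) = - q * (\<Sum>j<a. u j * g j)"
      by (simp add: z_def sum_distrib_left mult.assoc)
    moreover have "(\<Sum>j<c. z (a + j) * h j) = (\<Sum>j<c. v j * h j)"
      by (simp add: z_def)
    ultimately have "(\<Sum>j<a + c. z j * G j) - e = x * (- q * (\<Sum>j<a. u j * g j)) + (f + x * q)"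
      unfolding G using q by (simp add: algebra_simps)
    also have "\<dots> = f - q * (x * ((\<Sum>j<a. u j * g j) - 1))"
      by (simp add: algebra_simps)
    also have "\<dots> \<in> I"
      by (intro is_ideal_diff[OF I] f is_ideal_mult[OF I] u)
    finally show ?thesis
      using v by (intro bexI[of _ z]) (auto simp: z_def fvecs_def)
  qed
  let ?K = "{v \<in> fvecs (a + c). (\<Sum>j<a + c. v j * G j) \<in> I}"
  have "has_resolution p (a + c) ?K"
  proof (rule has_resolution_horseshoe)
    have "(\<Sum>j<n. k * v j * G j) = k * (\<Sum>j<n. v j * G j)" for k v and n :: nat
      by (simp add: sum_distrib_left mult.assoc)
    then show "submod ?K"
      by (auto simp: submod_def fvecs_def distrib_right sum.distrib
          intro: is_ideal_add[OF I] is_ideal_mult[OF I] is_ideal_zero[OF I])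
    have "?K \<inter> fvecs a = {v \<in> fvecs a. x * (\<Sum>j<a. v j * g j) \<in> I}"
      unfolding G by (auto simp: fvecs_def)
    with resA show "has_resolution p a (?K \<inter> fvecs a)"
      by (simp only:)
    have "(\<lambda>v i. v (a + i)) ` ?K = {v \<in> fvecs c. (\<Sum>j<c. v j * h j) \<in> {f + x * h | f h. f \<in> I}}"
      (is "?l = ?r")
    proof
      show "?l \<subseteq> ?r"
      proof
        fix z assume "z \<in> ?l"
        then obtain v where v: "v \<in> fvecs (a + c)" "(\<Sum>j<a + c. v j * G j) \<in> I"
          and z: "z = (\<lambda>i. v (a + i))"
          by blast
        have "(\<Sum>j<c. z j * h j) = (\<Sum>j<a + c. v j * G j) + x * (- (\<Sum>j<a. v j * g j))"
          unfolding G z by simp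
        with v(2) have "(\<Sum>j<c. z j * h j) \<in> {f + x * h | f h. f \<in> I}"
          by blast
        with v(1) z show "z \<in> ?r"
          by (simp add: fvecs_def)
      qed
      show "?r \<subseteq> ?l"
      proof
        fix v assume "v \<in> ?r"
        then obtain z where "z \<in> fvecs (a + c)" "(\<lambda>j. z (a + j)) = v" "(\<Sum>j<a + c. z j * G j) - 0 \<in> I"
          using lift[of v 0] by auto
        then show "v \<in> ?l" by auto
      qed
    qed
    with resC show "has_resolution p c ((\<lambda>v i. v (a + i)) ` ?K)"
      by (simp only:)
  qed auto
  moreover obtain z where "z \<in> fvecs (a + c)" "(\<Sum>j<a + c. z j * G j) - 1 \<in> I"
    using lift[OF w] by blast
  ultimately show ?thesis
    unfolding pd_quot_le_def by blast
qed

section \<open>Monomial ideals\<close>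

text \<open>For \<open>Q\<close> closed under adding exponents this is the ideal spanned by the
  monomials in \<open>Q\<close>. Describing it by supports turns identities of ideals into
  identities of exponent sets.\<close>

definition monomial_ideal :: "('v \<Rightarrow>\<^sub>0 nat) set \<Rightarrow> ('v, 'k::field) mpoly set" where
  "monomial_ideal Q = {f. Poly_Mapping.keys f \<subseteq> Q}"

lemma is_ideal_monomial_ideal:
  assumes "\<And>m n. n \<in> Q \<Longrightarrow> m + n \<in> Q"
  shows "is_ideal (monomial_ideal Q)"
proof -
  have "Poly_Mapping.keys (c * f) \<subseteq> Q" if "Poly_Mapping.keys f \<subseteq> Q" for c f :: "('a, 'b) mpoly"
    using that keys_mult[of c f] assms by fastforce
  moreover have "Poly_Mapping.keys (f + g) \<subseteq> Q"
    if "Poly_Mapping.keys f \<subseteq> Q" "Poly_Mapping.keys g \<subseteq> Q" for f g :: "('a, 'b) mpoly"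
    using that keys_add[of f g] by blast
  ultimately show ?thesis
    by (auto simp: is_ideal_def monomial_ideal_def)
qed

lemma lookup_Var_mult: "Poly_Mapping.lookup (Var x * f) (Poly_Mapping.single x 1 + m) = Poly_Mapping.lookup f m"
  for f :: "('v, 'k::field) mpoly"
proof -
  have "(\<Sum>q. Poly_Mapping.lookup f q when Poly_Mapping.single x 1 + m = Poly_Mapping.single x 1 + q) = Poly_Mapping.lookup f m"
    by simp
  then show ?thesis
    by (simp add: lookup_mult Var_def lookup_single when_mult)
qed

text \<open>Multiplication by a variable translates exponents injectively, so no terms merge or
  cancel.\<close>

lemma keys_Var_mult: "Poly_Mapping.keys (Var x * f) = (+) (Poly_Mapping.single x 1) ` Poly_Mapping.keys f"
  for f :: "('v, 'k::field) mpoly"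
proof
  show "Poly_Mapping.keys (Var x * f) \<subseteq> (+) (Poly_Mapping.single x 1) ` Poly_Mapping.keys f"
    using keys_mult[of "Var x" f] by (auto simp: Var_def)
  show "(+) (Poly_Mapping.single x 1) ` Poly_Mapping.keys f \<subseteq> Poly_Mapping.keys (Var x * f)"
    using lookup_Var_mult[of x f] by (auto simp: in_keys_iff)
qed

lemma Var_mult_mem_monomial_ideal:
  "Var x * f \<in> monomial_ideal Q \<longleftrightarrow> f \<in> monomial_ideal {m. Poly_Mapping.single x 1 + m \<in> Q}"
  by (auto simp: monomial_ideal_def keys_Var_mult)

lemma monomial_ideal_induct [consumes 1, case_names zero add]:
  assumes "f \<in> monomial_ideal Q"
    and "P 0"
    and "\<And>m c f. m \<in> Q \<Longrightarrow> P f \<Longrightarrow> P (Poly_Mapping.single m c + f)"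
  shows "P f"
proof -
  have "Poly_Mapping.keys f \<subseteq> Q \<longrightarrow> P f"
  proof (induction f rule: Poly_Mapping.update_induct)
    case const
    then show ?case using assms(2) by simp
  next
    case (update f a b)
    have "Poly_Mapping.update a b f = Poly_Mapping.single a b + f"
      using update(1) by (intro poly_mapping_eqI) (auto simp: lookup_update lookup_add lookup_single in_keys_iff when_def)
    moreover have "Poly_Mapping.keys (Poly_Mapping.update a b f) = insert a (Poly_Mapping.keys f)"
      using update(1,2) by (auto simp: in_keys_iff lookup_update split: if_splits)
    ultimately show ?case
      using update(3) assms(3) by auto
  qed
  then show ?thesis
    using assms(1) by (simp add: monomial_ideal_def)
qed

lemma single_split_monomial:
  assumes "Poly_Mapping.lookup m x \<noteq> 0"
  shows "Poly_Mapping.single m c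
    = (Var x * Poly_Mapping.single (m - Poly_Mapping.single x 1) c :: ('v, 'k::field) mpoly)"
proof -
  have "Poly_Mapping.single x 1 + (m - Poly_Mapping.single x 1) = m"
    using assms by (intro poly_mapping_eqI) (auto simp: lookup_add lookup_minus lookup_single when_def)
  then show ?thesis
    by (simp add: Var_def mult_single)
qed

text \<open>Each term of a polynomial on the right has its exponent in \<open>Q\<close> or is
  divisible by \<open>Var x\<close>, so it can be sorted into one of the two summands.\<close>

lemma monomial_ideal_plus_Var:
  assumes "\<And>m n. n \<in> Q \<Longrightarrow> m + n \<in> Q"
  shows "{f + Var x * h | f h. f \<in> monomial_ideal Q}
    = (monomial_ideal (Q \<union> {m. Poly_Mapping.lookup m x \<noteq> 0}) :: ('v, 'k::field) mpoly set)" (is "?l = ?r")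
proof
  have r: "is_ideal ?r"
    using assms by (intro is_ideal_monomial_ideal) (auto simp: lookup_add)
  show "?l \<subseteq> ?r"
  proof
    fix z assume "z \<in> ?l"
    then obtain f h where f: "f \<in> monomial_ideal Q" and z: "z = f + Var x * h"
      by blast
    have "f \<in> ?r"
      using f by (auto simp: monomial_ideal_def)
    moreover have "Var x * h \<in> ?r"
      by (auto simp: Var_mult_mem_monomial_ideal) (auto simp: monomial_ideal_def lookup_add)
    ultimately show "z \<in> ?r"
      unfolding z by (rule is_ideal_add[OF r])
  qed
  have Q: "is_ideal (monomial_ideal Q :: ('v, 'k) mpoly set)"
    using assms by (rule is_ideal_monomial_ideal)
  show "?r \<subseteq> ?l"
  proof
    fix z assume "z \<in> ?r"
    then show "z \<in> ?l"
    proof (induction z rule: monomial_ideal_induct)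
      case zero
      show ?case
        by (intro CollectI exI[of _ 0]) (simp add: is_ideal_zero[OF Q])
    next
      case (add m c z)
      then obtain f h where fh: "f \<in> monomial_ideal Q" "z = f + Var x * h"
        by blast
      show ?case
      proof (cases "m \<in> Q")
        case True
        then have "Poly_Mapping.single m c \<in> monomial_ideal Q"
          by (simp add: monomial_ideal_def)
        with fh show ?thesis
          by (intro CollectI exI[of _ "Poly_Mapping.single m c + f"] exI[of _ h])
            (simp add: is_ideal_add[OF Q] add.assoc)
      next
        case False
        with add have "Poly_Mapping.lookup m x \<noteq> 0" by simp
        from single_split_monomial[OF this, of c] fh show ?thesis
          by (intro CollectI exI[of _ f]
              exI[of _ "Poly_Mapping.single (m - Poly_Mapping.single x 1) c + h"])
            (simp add: distrib_left add_ac)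
      qed
    qed
  qed
qed

section \<open>Edge ideals with some variables adjoined\<close>

text \<open>The monomials of the ideal generated by \<open>I(G)\<close> and the variables in \<open>W\<close>, provided that \<open>E\<close> is
  irreflexive.\<close>

definition graph_monomials :: "('v \<Rightarrow> 'v \<Rightarrow> bool) \<Rightarrow> 'v set \<Rightarrow> ('v \<Rightarrow>\<^sub>0 nat) set" where
  "graph_monomials E W = {m. (\<exists>w\<in>W. Poly_Mapping.lookup m w \<noteq> 0)
     \<or> (\<exists>u v. E u v \<and> Poly_Mapping.lookup m u \<noteq> 0 \<and> Poly_Mapping.lookup m v \<noteq> 0)}"

lemma graph_monomials_add: "n \<in> graph_monomials E W \<Longrightarrow> m + n \<in> graph_monomials E W"
  by (auto simp: graph_monomials_def lookup_add)

lemma is_ideal_graph_monomials: "is_ideal (monomial_ideal (graph_monomials E W))"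
  by (rule is_ideal_monomial_ideal) (rule graph_monomials_add)

lemma graph_monomials_insert:
  "graph_monomials E (insert x W) = graph_monomials E W \<union> {m. Poly_Mapping.lookup m x \<noteq> 0}"
  by (auto simp: graph_monomials_def)

text \<open>Multiplying by \<open>x\<close> puts a new monomial into the ideal only by completing an
  edge at \<open>x\<close>, which takes a neighbour of \<open>x\<close> in the support;
  \<open>x \<notin> W\<close> and irreflexivity rule out membership through \<open>x\<close>
  alone.\<close>

lemma graph_monomials_colon:
  fixes E :: "'v \<Rightarrow> 'v \<Rightarrow> bool"
  assumes "\<And>u v. E u v \<Longrightarrow> E v u" "\<And>u. \<not> E u u" "x \<notin> W"
  shows "{m. Poly_Mapping.single x 1 + m \<in> graph_monomials E W} = graph_monomials E (W \<union> {y. E x y})"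
proof -
  have support: "Poly_Mapping.lookup (Poly_Mapping.single x 1 + m) u \<noteq> 0 \<longleftrightarrow> u = x \<or> Poly_Mapping.lookup m u \<noteq> 0"
    for m :: "'v \<Rightarrow>\<^sub>0 nat" and u
    by (auto simp: lookup_add lookup_single when_def)
  show ?thesis
    unfolding graph_monomials_def mem_Collect_eq support using assms by blast
qed

text \<open>Without loops the two variables of an edge are distinct, so a monomial divisible by both
  is divisible by their product.\<close>

lemma edge_ideal_eq_monomial_ideal:
  fixes E :: "'v::finite \<Rightarrow> 'v \<Rightarrow> bool"
  assumes "\<And>u. \<not> E u u"
  shows "edge_ideal E = (monomial_ideal (graph_monomials E {}) :: ('v, 'k::field) mpoly set)"
    (is "_ = ?I")
proof
  have I: "is_ideal ?I"
    by (rule is_ideal_graph_monomials)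
  have edge: "c * Var u * Var v \<in> ?I" if "E u v" for u v c
  proof -
    have "c * (Var u * Var v) \<in> ?I"
    proof (rule is_ideal_mult[OF I])
      have "Poly_Mapping.single u 1 + Poly_Mapping.single v 1 \<in> graph_monomials E {}"
        unfolding graph_monomials_def using that
        by (intro CollectI disjI2 exI[of _ u] exI[of _ v]) (simp add: lookup_add)
      then show "Var u * Var v \<in> ?I"
        by (simp add: monomial_ideal_def Var_def mult_single)
    qed
    then show ?thesis by (simp add: mult.assoc)
  qed
  have "(\<Sum>(u, v) \<in> A. c u v * Var u * Var v) \<in> ?I" if "A \<subseteq> {(u, v). E u v}" for A c
    using finite[of A] that
    by (induction A rule: finite_induct) (auto simp: is_ideal_zero[OF I] intro!: is_ideal_add[OF I] edge)
  then show "edge_ideal E \<subseteq> ?I"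
    by (auto simp: edge_ideal_def)
  show "?I \<subseteq> edge_ideal E"
  proof
    fix f assume "f \<in> ?I"
    then show "f \<in> edge_ideal E"
    proof (induction f rule: monomial_ideal_induct)
      case zero
      show ?case
        unfolding edge_ideal_def by (intro CollectI exI[of _ "\<lambda>_ _. 0"]) (simp add: case_prod_unfold)
    next
      case (add m b f)
      then obtain u v where uv: "E u v" "Poly_Mapping.lookup m u \<noteq> 0" "Poly_Mapping.lookup m v \<noteq> 0"
        by (auto simp: graph_monomials_def)
      obtain c where f: "f = (\<Sum>(u, v) \<in> {(u, v). E u v}. c u v * Var u * Var v)"
        using add unfolding edge_ideal_def by blast
      let ?n = "m - Poly_Mapping.single u 1"
      have "u \<noteq> v"
        using uv assms by blast
      then have "Poly_Mapping.lookup ?n v \<noteq> 0"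
        using uv(3) by (simp add: lookup_minus lookup_single)
      from single_split_monomial[OF uv(2), of b] single_split_monomial[OF this, of b]
      have "Poly_Mapping.single m b
          = Poly_Mapping.single (?n - Poly_Mapping.single v 1) b * Var u * Var v"
        by (simp add: mult_ac)
      then obtain g where g: "Poly_Mapping.single m b = g * Var u * Var v" ..
      have "(\<Sum>(a, b) \<in> {(a, b). E a b}. (if (a, b) = (u, v) then g else 0) * Var a * Var b)
          = (\<Sum>e \<in> {(a, b). E a b}. if e = (u, v) then g * Var u * Var v else 0)"
        by (intro sum.cong) (auto split: if_splits)
      also have "\<dots> = g * Var u * Var v"
        using uv(1) by (simp add: sum.delta)
      finally have "Poly_Mapping.single m b + f
          = (\<Sum>(a, b) \<in> {(a, b). E a b}. ((if (a, b) = (u, v) then g else 0) + c a b) * Var a * Var b)"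
        unfolding f g by (simp add: distrib_right sum.distrib case_prod_unfold)
      then show ?case
        unfolding edge_ideal_def
        by (intro CollectI exI[of _ "\<lambda>x y. (if (x, y) = (u, v) then g else 0) + c x y"])
    qed
  qed
qed

text \<open>Isolated vertices of \<open>G - W\<close> only contribute free variables and leave the
  projective dimension unchanged, so the induction counts the others.\<close>

definition nonisolated :: "('v \<Rightarrow> 'v \<Rightarrow> bool) \<Rightarrow> 'v set \<Rightarrow> 'v set" where
  "nonisolated E W = {u. u \<notin> W \<and> (\<exists>v. v \<notin> W \<and> E u v)}"

text \<open>The variables of \<open>W\<close> form a regular sequence, and each raises the bound by
  one.\<close>

lemma pd_quot_le_variables:
  fixes W :: "'v::finite set"
  shows "pd_quot_le (monomial_ideal (graph_monomials (\<lambda>_ _. False) W) :: ('v, 'k::field) mpoly set) (card W)"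
  using finite[of W]
proof (induction W rule: finite_induct)
  case empty
  have "(monomial_ideal (graph_monomials (\<lambda>_ _. False) {}) :: ('v, 'k) mpoly set) = {0}"
    by (auto simp: monomial_ideal_def graph_monomials_def)
  then show ?case using pd_quot_le_zero_ideal by simp
next
  case (insert x W)
  let ?I = "monomial_ideal (graph_monomials (\<lambda>_ _. False) W) :: ('v, 'k) mpoly set"
  have "pd_quot_le {f + Var x * h | f h. f \<in> ?I} (Suc (card W))"
  proof (rule pd_quot_le_regular_element)
    show "f \<in> ?I" if "Var x * f \<in> ?I" for f
      using that insert(2) unfolding Var_mult_mem_monomial_ideal
      by (subst (asm) graph_monomials_colon) auto
  qed (use insert in \<open>auto intro: is_ideal_graph_monomials\<close>)
  also have "{f + Var x * h | f h. f \<in> ?I} = monomial_ideal (graph_monomials (\<lambda>_ _. False) (insert x W))"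
    unfolding graph_monomials_insert by (rule monomial_ideal_plus_Var) (rule graph_monomials_add)
  finally show ?case using insert by simp
qed

text \<open>Every edge meets \<open>W\<close>, so the edge monomials already lie in the ideal
  generated by the variables of \<open>W\<close>.\<close>

lemma pd_quot_le_edgeless:
  fixes E :: "'v::finite \<Rightarrow> 'v \<Rightarrow> bool"
  assumes "nonisolated E W = {}"
  shows "pd_quot_le (monomial_ideal (graph_monomials E W) :: ('v, 'k::field) mpoly set) (card W)"
proof -
  have "graph_monomials E W = graph_monomials (\<lambda>_ _. False) W"
    using assms by (auto simp: graph_monomials_def nonisolated_def)
  then show ?thesis using pd_quot_le_variables by simp
qed

text \<open>The two ends of the colon sequence for \<open>Var x\<close>: one branch deletes
  \<open>x\<close>, the other adjoins its neighbours and so isolates \<open>x\<close>.\<close>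

lemma pd_quot_le_delete_vertex:
  fixes E :: "'v::finite \<Rightarrow> 'v \<Rightarrow> bool"
  assumes "\<And>u v. E u v \<Longrightarrow> E v u" "\<And>u. \<not> E u u" "x \<notin> W"
    and "pd_quot_le (monomial_ideal (graph_monomials E (insert x W)) :: ('v, 'k::field) mpoly set) q"
    and "pd_quot_le (monomial_ideal (graph_monomials E (W \<union> {y. E x y})) :: ('v, 'k) mpoly set) q"
  shows "pd_quot_le (monomial_ideal (graph_monomials E W) :: ('v, 'k) mpoly set) q"
proof (rule pd_quot_le_colon[where x = "Var x"])
  have "{f. Var x * f \<in> monomial_ideal (graph_monomials E W)}
      = (monomial_ideal (graph_monomials E (W \<union> {y. E x y})) :: ('v, 'k) mpoly set)"
    using graph_monomials_colon[of E x W, OF assms(1-3)] by (simp add: Var_mult_mem_monomial_ideal)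
  then show "pd_quot_le {f :: ('v, 'k) mpoly. Var x * f \<in> monomial_ideal (graph_monomials E W)} q"
    using assms(5) by (simp only:)
  have "{f + Var x * h | f h. f \<in> monomial_ideal (graph_monomials E W)}
      = (monomial_ideal (graph_monomials E (insert x W)) :: ('v, 'k) mpoly set)"
    unfolding graph_monomials_insert by (rule monomial_ideal_plus_Var) (rule graph_monomials_add)
  then show "pd_quot_le {f + Var x * h | f (h :: ('v, 'k) mpoly). f \<in> monomial_ideal (graph_monomials E W)} q"
    using assms(4) by (simp only:)
qed (rule is_ideal_graph_monomials)

section \<open>The deletion argument\<close>

text \<open>Adjoining \<open>k \<le> d\<close> variables while at least \<open>k + 1\<close>
  vertices stop being non-isolated costs at most \<open>d / (d + 1)\<close> per lost vertex; the
  factor \<open>Suc d\<close> clears this denominator. The hypothesis \<open>order\<close> collects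
  what the lattice has to provide.\<close>

lemma pd_quot_le_by_deletion_order:
  fixes E :: "'v::finite \<Rightarrow> 'v \<Rightarrow> bool" and d :: nat
  assumes sym: "\<And>u v. E u v \<Longrightarrow> E v u" and irrefl: "\<And>u. \<not> E u u"
    and order: "\<And>W. nonisolated E W \<noteq> {} \<Longrightarrow> \<exists>u\<in>nonisolated E W. \<exists>key :: 'v \<Rightarrow> int.
      inj_on key ({y. E u y} - W) \<and> card ({y. E u y} - W) \<le> d
      \<and> (\<forall>x \<in> {y. E u y} - W.
            card {y \<in> {y. E u y} - W. key x < key y} + card ({y. E x y} - W) \<le> d)"
  shows "\<exists>q. Suc d * q \<le> Suc d * card W + d * card (nonisolated E W)
    \<and> pd_quot_le (monomial_ideal (graph_monomials E W) :: ('v, 'k::field) mpoly set) q"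
proof (induction "card (- W)" arbitrary: W rule: less_induct)
  case outer: less
  let ?I = "\<lambda>W. monomial_ideal (graph_monomials E W) :: ('v, 'k) mpoly set"
  let ?bound = "Suc d * card W + d * card (nonisolated E W)"
  show ?case
  proof (cases "nonisolated E W = {}")
    case True
    then show ?thesis
      using pd_quot_le_edgeless by (intro exI[of _ "card W"]) auto
  next
    case False
    then obtain u and key :: "'v \<Rightarrow> int" where u: "u \<in> nonisolated E W"
      and inj: "inj_on key ({y. E u y} - W)" and deg: "card ({y. E u y} - W) \<le> d"
      and sum: "\<And>x. x \<in> {y. E u y} - W \<Longrightarrow>
          card {y \<in> {y. E u y} - W. key x < key y} + card ({y. E x y} - W) \<le> d"
      using order by meson
    let ?N = "{y. E u y} - W"
    have N_nonisolated: "?N \<subseteq> nonisolated E W"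
      using u sym by (auto simp: nonisolated_def)
    \<comment> \<open>Adjoining \<open>Y\<close> kills the vertex \<open>v\<close> as well, which saves \<open>d\<close> in the bound and so pays
      for the \<open>card Y \<le> d\<close> new variables.\<close>
    have isolate: "\<exists>q. Suc d * q \<le> ?bound \<and> pd_quot_le (?I (W \<union> Y)) q"
      if Y: "Y \<subseteq> nonisolated E W" and v: "v \<in> nonisolated E W" "v \<notin> Y" "{y. E v y} \<subseteq> W \<union> Y" and cY: "card Y \<le> d"
      for Y v
    proof -
      \<comment> \<open>\<open>v\<close> has a neighbour outside \<open>W\<close>, which must lie in
        \<open>Y\<close>; so \<open>Y\<close> is nonempty and the outer induction applies.\<close>
      have "Y \<noteq> {}" "W \<inter> Y = {}"
        using v Y by (auto simp: nonisolated_def)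
      then have "card (- (W \<union> Y)) < card (- W)"
        by (intro psubset_card_mono) auto
      from outer[OF this] obtain q where q: "pd_quot_le (?I (W \<union> Y)) q"
        "Suc d * q \<le> Suc d * card (W \<union> Y) + d * card (nonisolated E (W \<union> Y))"
        by blast
      have "nonisolated E (W \<union> Y) \<subseteq> nonisolated E W - insert v Y"
        using v by (auto simp: nonisolated_def)
      then have "card (nonisolated E (W \<union> Y)) \<le> card (nonisolated E W - insert v Y)"
        by (intro card_mono) auto
      also have "\<dots> = card (nonisolated E W) - Suc (card Y)"
        using v Y by (subst card_Diff_subset) auto
      finally have "card (nonisolated E (W \<union> Y)) \<le> card (nonisolated E W) - Suc (card Y)" .
      moreover have "Suc (card Y) \<le> card (nonisolated E W)"
        using card_mono[of "nonisolated E W" "insert v Y"] v Y by auto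
      ultimately have "card (nonisolated E (W \<union> Y)) + Suc (card Y) \<le> card (nonisolated E W)"
        by linarith
      then have "d * (card (nonisolated E (W \<union> Y)) + Suc (card Y)) \<le> d * card (nonisolated E W)"
        by (rule mult_le_mono2)
      \<comment> \<open>From \<open>card Y \<le> d\<close> follows
        \<open>Suc d * card Y \<le> d * Suc (card Y)\<close>.\<close>
      then have "Suc d * card (W \<union> Y) + d * card (nonisolated E (W \<union> Y)) \<le> ?bound"
        using cY \<open>W \<inter> Y = {}\<close> by (simp add: card_Un_disjoint algebra_simps)
      with q show ?thesis
        by (intro exI[of _ q]) simp
    qed
    \<comment> \<open>\<open>X\<close> is the set of neighbours of \<open>u\<close> deleted so far,
      closed upwards for \<open>key\<close>. The induction is on the number of neighbours left, and
      \<open>X = {}\<close> is the goal.\<close>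
    have "\<exists>q. Suc d * q \<le> ?bound \<and> pd_quot_le (?I (W \<union> X)) q"
      if "X \<subseteq> ?N" "\<And>x y. x \<in> X \<Longrightarrow> y \<in> ?N \<Longrightarrow> key x \<le> key y \<Longrightarrow> y \<in> X" for X
      using that
    proof (induction "card (?N - X)" arbitrary: X rule: less_induct)
      case (less X)
      show ?case
      proof (cases "X = ?N")
        case True
        \<comment> \<open>With all its neighbours adjoined, \<open>u\<close> itself is the extra
          vertex that becomes isolated.\<close>
        show ?thesis
          unfolding True using N_nonisolated u irrefl deg by (intro isolate[of _ u]) auto
      next
        case False
        \<comment> \<open>Deleting the remaining neighbour of largest key keeps the deleted set
          closed upwards.\<close>
        then have "Max (key ` (?N - X)) \<in> key ` (?N - X)"
          using less.prems(1) by (intro Max_in) auto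
        then obtain x where x: "x \<in> ?N - X" and "key x = Max (key ` (?N - X))"
          by (metis (no_types, lifting) imageE)
        then have max: "key y \<le> key x" if "y \<in> ?N - X" for y
          using that by simp
        have "\<exists>q. Suc d * q \<le> ?bound \<and> pd_quot_le (?I (W \<union> insert x X)) q"
        proof (rule less.hyps)
          show "card (?N - insert x X) < card (?N - X)"
            using x by (intro psubset_card_mono) auto
          show "insert x X \<subseteq> ?N"
            using x less.prems(1) by blast
          show "y \<in> insert x X" if "z \<in> insert x X" "y \<in> ?N" "key z \<le> key y" for z y
          proof (cases "y \<in> X \<or> z \<in> X")
            case True
            then show ?thesis using that less.prems(2) by blast
          next
            case False
            with that max have "key y = key x" by force
            then show ?thesis using inj x that by (auto dest: inj_onD)
          qed
        qed
        then obtain q1 where q1: "Suc d * q1 \<le> ?bound" "pd_quot_le (?I (insert x (W \<union> X))) q1"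
          by auto
        \<comment> \<open>In the colon branch all of \<open>?Y\<close> has been adjoined to
          \<open>W\<close>. Elements of \<open>X\<close> have a larger key than \<open>x\<close>,
          because \<open>x\<close> lies outside the upward closed \<open>X\<close>; so
          \<open>sum\<close> bounds \<open>card ?Y\<close> by \<open>d\<close>. The vertex that
          becomes isolated is now \<open>x\<close>.\<close>
        let ?Y = "X \<union> ({y. E x y} - W)"
        have "X \<subseteq> {y \<in> ?N. key x < key y}"
          using less.prems x by force
        then have "card X \<le> card {y \<in> ?N. key x < key y}"
          by (intro card_mono) auto
        with sum[of x] x have "card ?Y \<le> d"
          using card_Un_le[of X "{y. E x y} - W"] by fastforce
        moreover have "?Y \<subseteq> nonisolated E W"
          using less.prems(1) N_nonisolated x sym by (auto simp: nonisolated_def)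
        ultimately have "\<exists>q. Suc d * q \<le> ?bound \<and> pd_quot_le (?I (W \<union> ?Y)) q"
          using x N_nonisolated irrefl by (intro isolate[of _ x]) auto
        moreover have "W \<union> ?Y = W \<union> X \<union> {y. E x y}"
          by auto
        ultimately obtain q2 where q2: "Suc d * q2 \<le> ?bound" "pd_quot_le (?I (W \<union> X \<union> {y. E x y})) q2"
          by auto
        have "pd_quot_le (?I (W \<union> X)) (max q1 q2)"
        proof (rule pd_quot_le_delete_vertex[OF sym irrefl])
          show "x \<notin> W \<union> X"
            using x by blast
        qed (assumption | rule pd_quot_le_mono[OF q1(2)] pd_quot_le_mono[OF q2(2)], simp)+
        with q1(1) q2(1) show ?thesis
          by (intro exI[of _ "max q1 q2"]) (simp add: max_def)
      qed
    qed
    from this[of "{}"] show ?thesis by simp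
  qed
qed

section \<open>Subgraphs of the lattice\<close>

text \<open>A sum of squares of integers equals 1 only if a single summand is nonzero and that one
  is 1.\<close>

lemma lattice_adj_axis:
  assumes "lattice_adj a b"
  obtains m where "b = a + axis m 1" | m where "b = a - axis m 1"
proof -
  have sum: "(\<Sum>i\<in>UNIV. (a $ i - b $ i)^2) = 1"
    using assms by (simp add: lattice_adj_def flip: of_int_sum)
  then have "(\<Sum>i\<in>UNIV. (a $ i - b $ i)^2) \<noteq> 0"
    by simp
  then obtain m where m: "(a $ m - b $ m)^2 \<noteq> 0"
    by (rule sum.not_neutral_contains_not_neutral)
  have split: "(a $ m - b $ m)^2 + (\<Sum>i\<in>UNIV - {m}. (a $ i - b $ i)^2) = 1"
    using sum by (simp add: sum.remove[of UNIV m])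
  have ge: "(a $ m - b $ m)^2 > 0" "(\<Sum>i\<in>UNIV - {m}. (a $ i - b $ i)^2) \<ge> 0"
    using m by (auto intro: sum_nonneg)
  then have "(\<Sum>i\<in>UNIV - {m}. (a $ i - b $ i)^2) = 0"
    using split by linarith
  then have off: "a $ i = b $ i" if "i \<noteq> m" for i
    using that by (subst (asm) sum_nonneg_eq_0_iff) auto
  have "(a $ m - b $ m)^2 = 1"
    using split ge by linarith
  then have "b $ m = a $ m + 1 \<or> b $ m = a $ m - 1"
    by (auto simp: power2_eq_1_iff)
  then show ?thesis
  proof
    assume "b $ m = a $ m + 1"
    then have "b = a + axis m 1"
      using off by (auto simp: vec_eq_iff axis_def)
    then show ?thesis by (rule that(1))
  next
    assume "b $ m = a $ m - 1"
    then have "b = a - axis m 1"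
      using off by (auto simp: vec_eq_iff axis_def)
    then show ?thesis by (rule that(2))
  qed
qed

lemma lattice_deletion_order:
  fixes p :: "'v::finite \<Rightarrow> int ^ 'l"
  assumes G: "lattice_subgraph p E" and "nonisolated E W \<noteq> {}"
  shows "\<exists>u\<in>nonisolated E W. \<exists>key :: 'v \<Rightarrow> int.
    inj_on key ({y. E u y} - W) \<and> card ({y. E u y} - W) \<le> 2 * CARD('l)
    \<and> (\<forall>x \<in> {y. E u y} - W.
          card {y \<in> {y. E u y} - W. key x < key y} + card ({y. E x y} - W) \<le> 2 * CARD('l))"
proof -
  have p: "inj p" and sym: "\<And>u v. E u v \<Longrightarrow> E v u" and adj: "\<And>u v. E u v \<Longrightarrow> lattice_adj (p u) (p v)"
    using G by (auto simp: lattice_subgraph_def)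
  obtain c :: "'l \<Rightarrow> nat" where c: "inj c"
    using finite_imp_inj_to_nat_seg[of "UNIV :: 'l set"] by auto
  \<comment> \<open>The coefficients are distinct as \<open>c\<close> is injective, and
    \<open>Suc\<close> makes them positive, so subtracting a unit vector strictly lowers
    \<open>\<phi>\<close>.\<close>
  define \<phi> :: "int ^ 'l \<Rightarrow> int" where "\<phi> a = (\<Sum>i\<in>UNIV. int (Suc (c i)) * a $ i)" for a
  have axis: "(\<Sum>i\<in>UNIV. int (Suc (c i)) * (axis m 1 :: int ^ 'l) $ i) = int (Suc (c m))" for m
    by (simp add: axis_def if_distrib[of "\<lambda>x. _ * x"] sum.delta cong: if_cong del: of_nat_Suc)
  have \<phi>_plus: "\<phi> (a + axis m 1) = \<phi> a + int (Suc (c m))"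
    and \<phi>_minus: "\<phi> (a - axis m 1) = \<phi> a - int (Suc (c m))" for a m
    unfolding \<phi>_def vector_add_component vector_minus_component distrib_left right_diff_distrib
      sum.distrib sum_subtractf axis by (rule refl)+
  have card_p: "card A \<le> card B" if "p ` A \<subseteq> B" "finite B" for A B
    using card_mono[OF that(2,1)] card_image[of p A] p inj_on_subset by fastforce
  have "Min ((\<phi> \<circ> p) ` nonisolated E W) \<in> (\<phi> \<circ> p) ` nonisolated E W"
    using assms(2) by (intro Min_in) auto
  then obtain u where u: "u \<in> nonisolated E W" and "\<phi> (p u) = Min ((\<phi> \<circ> p) ` nonisolated E W)"
    by auto
  then have min: "\<phi> (p u) \<le> \<phi> (p y)" if "y \<in> nonisolated E W" for y
    using that by simp
  let ?N = "{y. E u y} - W"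
  \<comment> \<open>A neighbour at \<open>p u - axis m 1\<close> would lie below the
    minimum.\<close>
  have N: "\<exists>m. p y = p u + axis m 1" if "y \<in> ?N" for y
  proof -
    have "y \<in> nonisolated E W"
      using that u sym by (auto simp: nonisolated_def)
    from min[OF this] show ?thesis
      using that adj[of u y] by (auto elim!: lattice_adj_axis simp: \<phi>_minus)
  qed
  have inj: "inj_on (\<phi> \<circ> p) ?N"
  proof (rule inj_onI)
    fix y z assume yz: "y \<in> ?N" "z \<in> ?N" "(\<phi> \<circ> p) y = (\<phi> \<circ> p) z"
    obtain m n where "p y = p u + axis m 1" "p z = p u + axis n 1"
      using N yz by blast
    with yz(3) c have "p y = p z"
      by (auto simp: \<phi>_plus dest: injD)
    with p show "y = z" by (rule injD)
  qed
  have "p ` ?N \<subseteq> range (\<lambda>m. p u + axis m 1)"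
    using N by auto
  then have "card ?N \<le> card (range (\<lambda>m. p u + axis m 1))"
    by (rule card_p) auto
  also have "\<dots> \<le> CARD('l)"
    by (rule card_image_le) auto
  finally have deg: "card ?N \<le> 2 * CARD('l)"
    by simp
  have "card {y \<in> ?N. (\<phi> \<circ> p) x < (\<phi> \<circ> p) y} + card ({y. E x y} - W) \<le> 2 * CARD('l)" if x: "x \<in> ?N" for x
  proof -
    obtain j where j: "p x = p u + axis j 1"
      using N[OF x] by blast
    have "p ` {y \<in> ?N. (\<phi> \<circ> p) x < (\<phi> \<circ> p) y} \<subseteq> (\<lambda>m. p u + axis m 1) ` {m. c j < c m}"
      using N j by (fastforce simp: \<phi>_plus)
    then have "card {y \<in> ?N. (\<phi> \<circ> p) x < (\<phi> \<circ> p) y} \<le> card ((\<lambda>m. p u + axis m 1) ` {m. c j < c m})"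
      by (rule card_p) auto
    also have "\<dots> \<le> card {m. c j < c m}"
      by (rule card_image_le) auto
    finally have 1: "card {y \<in> ?N. (\<phi> \<circ> p) x < (\<phi> \<circ> p) y} \<le> card {m. c j < c m}" .
    \<comment> \<open>The point \<open>p x - axis m 1\<close> has value
      \<open>\<phi> (p u) + c j - c m\<close>, which minimality of \<open>u\<close> forbids for
      \<open>c m > c j\<close>; the direction \<open>m = j\<close> leads back to
      \<open>u\<close>.\<close>
    have "p y \<in> range (\<lambda>m. p x + axis m 1) \<union> (\<lambda>m. p x - axis m 1) ` {m. c m \<le> c j}"
      if y: "y \<in> {y. E x y} - W" for y
    proof -
      have "y \<in> nonisolated E W"
        using x y sym by (auto simp: nonisolated_def)
      from min[OF this] show ?thesis
        using y adj[of x y] by (auto elim!: lattice_adj_axis simp: \<phi>_minus \<phi>_plus j)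
    qed
    then have "p ` ({y. E x y} - W) \<subseteq> range (\<lambda>m. p x + axis m 1) \<union> (\<lambda>m. p x - axis m 1) ` {m. c m \<le> c j}"
      by (rule image_subsetI)
    then have "card ({y. E x y} - W)
        \<le> card (range (\<lambda>m. p x + axis m 1) \<union> (\<lambda>m. p x - axis m 1) ` {m. c m \<le> c j})"
      by (rule card_p) auto
    also have "\<dots> \<le> CARD('l) + card {m. c m \<le> c j}"
      by (rule order_trans[OF card_Un_le]) (intro add_mono card_image_le; simp)
    finally have 2: "card ({y. E x y} - W) \<le> CARD('l) + card {m. c m \<le> c j}" .
    \<comment> \<open>The directions of possible earlier deletions are exactly the downward
      directions excluded at \<open>x\<close>, so the two counts add up to the dimension.\<close>
    have "card {m. c j < c m} + card {m. c m \<le> c j} = card ({m. c j < c m} \<union> {m. c m \<le> c j})"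
      by (intro card_Un_disjoint[symmetric]) auto
    also have "{m. c j < c m} \<union> {m. c m \<le> c j} = UNIV"
      by auto
    finally show ?thesis using 1 2 by linarith
  qed
  with u inj deg show ?thesis
    by blast
qed

theorem theorem3p7:
  fixes p :: "'v::finite \<Rightarrow> int ^ 'l" and E :: "'v \<Rightarrow> 'v \<Rightarrow> bool"
  assumes "lattice_subgraph p E"
  shows "real (pd_graph TYPE('k::field) E)
           \<le> real CARD('v) * (1 - 1 / (2 * real CARD('l) + 1))"
proof -
  let ?d = "2 * CARD('l)"
  have sym: "\<And>u v. E u v \<Longrightarrow> E v u" and irrefl: "\<And>u. \<not> E u u"
    using assms by (auto simp: lattice_subgraph_def)
  \<comment> \<open>For \<open>W = {}\<close> no variable is adjoined and only the vertex term of
    the bound is left.\<close>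
  obtain q where q: "Suc ?d * q \<le> ?d * card (nonisolated E {})"
    and pd: "pd_quot_le (edge_ideal E :: ('v, 'k) mpoly set) q"
    using pd_quot_le_by_deletion_order[OF sym irrefl lattice_deletion_order[OF assms], where W = "{}" and 'k = 'k]
    unfolding edge_ideal_eq_monomial_ideal[OF irrefl] by auto
  have "Suc ?d * pd_graph TYPE('k) E \<le> Suc ?d * q"
    unfolding pd_graph_def using proj_dim_quot_le[OF pd] by (rule mult_le_mono2)
  also have "\<dots> \<le> ?d * CARD('v)"
    using q card_mono[of UNIV "nonisolated E {}"] by (meson finite_class.finite_UNIV le_trans mult_le_mono2 subset_UNIV)
  finally have "real (Suc ?d * pd_graph TYPE('k) E) \<le> real (?d * CARD('v))"
    by (simp only: of_nat_le_iff)
  then have "(2 * real CARD('l) + 1) * real (pd_graph TYPE('k) E) \<le> 2 * real CARD('l) * real CARD('v)"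
    by (simp only: of_nat_mult of_nat_Suc of_nat_numeral add.commute)
  moreover have "(2 * real CARD('l) + 1) * (real CARD('v) * (1 - 1 / (2 * real CARD('l) + 1)))
      = 2 * real CARD('l) * real CARD('v)"
    by (simp add: field_simps)
  ultimately show ?thesis
    by (metis add_nonneg_pos mult_le_cancel_left_pos mult_nonneg_nonneg of_nat_0_le_iff zero_le_numeral zero_less_one)
qed

end
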